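(* Let $\lambda\in\mathbb{R}$ with $\lambda\neq 0$, let $r$ be a nonnegative integer, and let $n$ be an integer with $n\ge 1$. Then, as an identity of rational functions in $x$ (equivalently, for all real $x\neq 0$), \begin{align*} \frac{1}{x}\phi_{n+1,\lambda}^{(r)}(x)&=\frac{d}{dx}\phi_{n,\lambda}^{(r)}(x)+\frac{r}{x}\frac{d}{dx}\phi_{n,\lambda}^{(r-1)}(x)+\phi_{n,\lambda}^{(r)}(x)+\frac{r}{x}\phi_{n,\lambda}^{(r-1)}(x) \\ &\quad -n\lambda\sum_{k=0}^{n-1}\binom{n-1}{k}(1)_{n-k,\lambda}\phi_{k,\lambda}^{(r)}(x)-\frac{r}{x}\,n\lambda\sum_{k=0}^{n-1}\binom{n-1}{k}(1)_{n-k,\lambda}\phi_{k,\lambda}^{(r-1)}(x). \end{align*}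
   Context: For $\lambda\in\mathbb{R}\setminus\{0\}$, the generalized falling factorial is $(x)_{0,\lambda}=1$ and $(x)_{n,\lambda}=x(x-\lambda)\cdots(x-(n-1)\lambda)$ for $n\ge1$. The degenerate exponential function is $e_{\lambda}^{x}(t)=(1+\lambda t)^{x/\lambda}=\sum_{n\ge0}(x)_{n,\lambda}\frac{t^n}{n!}$, and $e_\lambda(t)=e_\lambda^1(t)$. For an integer $s$, the degenerate $s$-Bell polynomials $\phi_{n,\lambda}^{(s)}(x)$ are defined by the generating function $e_{\lambda}^{s}(t)\,e^{x(e_{\lambda}(t)-1)}=\sum_{n=0}^{\infty}\phi_{n,\lambda}^{(s)}(x)\frac{t^{n}}{n!}$ (in particular this defines $\phi^{(r-1)}_{n,\lambda}$ also when $r=0$). *)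

theory Defs
  imports "HOL-Analysis.Analysis"
begin

definition gen_ffact :: "real \<Rightarrow> real \<Rightarrow> nat \<Rightarrow> real" where
  "gen_ffact lam x n = (\<Prod>i<n. x - real i * lam)"

text \<open>
  The degenerate exponential \<open>e\<^sub>\<lambda>\<^sup>x(t)\<close>, with \<open>lam\<close> for \<open>\<lambda>\<close>, as a formal power series in \<open>t\<close>.
  The lemma \<open>deg_exp_sums\<close> below shows that it sums to \<open>(1 + lam * t) powr (x / lam)\<close> for
  \<open>\<bar>lam * t\<bar> < 1\<close>.
\<close>
definition deg_exp :: "real \<Rightarrow> real \<Rightarrow> real fps" where
  "deg_exp lam x = Abs_fps (\<lambda>n. gen_ffact lam x n / fact n)"

lemma deg_exp_nth_0 [simp]: "fps_nth (deg_exp lam x) 0 = 1"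
  by (simp add: deg_exp_def gen_ffact_def)

lemma deg_exp_sums:
  assumes "lam \<noteq> 0" "\<bar>lam * t\<bar> < 1"
  shows "(\<lambda>n. fps_nth (deg_exp lam x) n * t ^ n) sums (1 + lam * t) powr (x / lam)"
proof -
  have "fps_nth (deg_exp lam x) n * t ^ n = ((x / lam) gchoose n) * (lam * t) ^ n" for n
  proof -
    have "gen_ffact lam x n = (\<Prod>i<n. lam * (x / lam - real i))"
      unfolding gen_ffact_def using assms(1) by (intro prod.cong) (auto simp: field_simps)
    also have "\<dots> = lam ^ n * (\<Prod>i<n. x / lam - real i)"
      by (simp add: prod.distrib)
    finally show ?thesis
      by (simp add: deg_exp_def gbinomial_prod_rev power_mult_distrib lessThan_atLeast0)
  qed
  then show ?thesis
    using gen_binomial_real[OF assms(2), of "x / lam"] by simp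
qed

text \<open>
  The factor \<open>fps_exp x oo (deg_exp lam 1 - 1)\<close> is the formal series of \<open>exp (x * (e\<^sub>\<lambda>(t) - 1))\<close> in \<open>t\<close>.
  Formal composition is meaningful here because \<open>deg_exp lam 1 - 1\<close> has zero constant term.
\<close>
definition deg_Bell_gf :: "real \<Rightarrow> int \<Rightarrow> real \<Rightarrow> real fps" where
  "deg_Bell_gf lam s x = deg_exp lam (of_int s) * (fps_exp x oo (deg_exp lam 1 - 1))"

definition deg_Bell :: "real \<Rightarrow> int \<Rightarrow> nat \<Rightarrow> real \<Rightarrow> real" where
  "deg_Bell lam s n x = fact n * fps_nth (deg_Bell_gf lam s x) n"

text \<open>
  These functions are polynomial in \<open>x\<close>, so \<open>deriv (deg_Bell lam s n)\<close> is a genuine derivative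
  everywhere.
\<close>
lemma deg_Bell_poly: "\<exists>p. \<forall>x. deg_Bell lam s n x = poly p x"
proof -
  define p where "p = (\<Sum>i=0..n. \<Sum>k=0..n-i. monom (fact n * fps_nth (deg_exp lam (of_int s)) i *
    fps_nth ((deg_exp lam 1 - 1) ^ k) (n - i) / fact k) k)"
  have "deg_Bell lam s n x = poly p x" for x
    by (simp add: deg_Bell_def deg_Bell_gf_def p_def fps_mult_nth fps_compose_nth poly_sum
        poly_monom sum_distrib_left mult_ac)
  then show ?thesis by blast
qed

lemma deg_Bell_differentiable: "deg_Bell lam s n differentiable at x"
proof -
  obtain p where "deg_Bell lam s n = poly p"
    using deg_Bell_poly[of lam s n] by auto
  then show ?thesis
    unfolding real_differentiable_def using poly_DERIV[of p x] by metis
qed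

end

theory Submission
  imports Defs
begin

text \<open>
  Write \<open>e = e\<^sub>\<lambda>(t)\<close> and \<open>G\<^sub>s = e\<^sup>s exp (x (e - 1))\<close>. Then \<open>\<partial>\<^sub>x G\<^sub>s = (e - 1) G\<^sub>s\<close> and
  \<open>\<partial>\<^sub>t G\<^sub>r = r e' G\<^sub>r\<^sub>-\<^sub>1 + x e' G\<^sub>r\<close>. Since \<open>(1 + \<lambda> t) e' = e\<close>, for every \<open>s\<close>
  \<open>e' G\<^sub>s = e G\<^sub>s - \<lambda> t e' G\<^sub>s = \<partial>\<^sub>x G\<^sub>s + G\<^sub>s - \<lambda> t e' G\<^sub>s\<close>.
  The recurrence is the coefficient of \<open>t\<^sup>n / n!\<close> in \<open>\<partial>\<^sub>t G\<^sub>r / x\<close>.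
\<close>

lemma gen_ffact_Suc: "gen_ffact lam x (Suc n) = gen_ffact lam x n * (x - real n * lam)"
  by (simp add: gen_ffact_def)

text \<open>Reduces \<open>(1 + lam * t) F' = c F\<close> to a two-term recurrence for coefficients;
  at \<open>n = 0\<close> the shifted term vanishes, hence the case split.\<close>

lemma fps_linear_ode_nth:
  fixes F :: "real fps"
  shows "fps_nth ((1 + fps_const lam * fps_X) * fps_deriv F) n =
    real (Suc n) * fps_nth F (Suc n) + lam * real n * fps_nth F n"
  by (cases n) (simp_all add: distrib_right mult.assoc)

lemma deg_exp_ode:
  "(1 + fps_const lam * fps_X) * fps_deriv (deg_exp lam x) = fps_const x * deg_exp lam x"
proof (rule fps_ext)
  fix n
  have "real (Suc n) * fps_nth (deg_exp lam x) (Suc n) = gen_ffact lam x (Suc n) / fact n"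
    by (simp add: deg_exp_def divide_simps)
  then show "fps_nth ((1 + fps_const lam * fps_X) * fps_deriv (deg_exp lam x)) n =
      fps_nth (fps_const x * deg_exp lam x) n"
    unfolding fps_linear_ode_nth
    by (simp add: deg_exp_def gen_ffact_Suc field_simps)
qed

text \<open>Since \<open>Suc n\<close> is invertible, the equation determines each coefficient from
  the previous one. This serves to recognise a product as a degenerate exponential.\<close>

lemma deg_exp_unique:
  assumes ode: "(1 + fps_const lam * fps_X) * fps_deriv F = fps_const c * F"
    and init: "fps_nth F 0 = 1"
  shows "F = deg_exp lam c"
proof (rule fps_ext)
  fix n
  show "fps_nth F n = fps_nth (deg_exp lam c) n"
  proof (induction n)
    case 0
    then show ?case by (simp add: init)
  next
    case (Suc n)
    have step: "real (Suc n) * fps_nth H (Suc n) = (c - lam * real n) * fps_nth H n"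
      if "(1 + fps_const lam * fps_X) * fps_deriv H = fps_const c * H" for H :: "real fps"
      using fps_linear_ode_nth[of lam H n] unfolding that by (simp add: algebra_simps)
    have "real (Suc n) * fps_nth F (Suc n) = real (Suc n) * fps_nth (deg_exp lam c) (Suc n)"
      using step[OF ode] step[OF deg_exp_ode] Suc.IH by simp
    then show ?case by (simp del: of_nat_Suc)
  qed
qed

text \<open>By Leibniz, the product solves the equation with constant \<open>x + y\<close>, and its
  constant term is 1.\<close>

lemma deg_exp_add: "deg_exp lam (x + y) = deg_exp lam x * deg_exp lam y"
proof (rule deg_exp_unique[symmetric])
  have "(1 + fps_const lam * fps_X) * fps_deriv (deg_exp lam x * deg_exp lam y) =
      ((1 + fps_const lam * fps_X) * fps_deriv (deg_exp lam x)) * deg_exp lam y +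
      deg_exp lam x * ((1 + fps_const lam * fps_X) * fps_deriv (deg_exp lam y))"
    by (simp add: algebra_simps)
  then show "(1 + fps_const lam * fps_X) * fps_deriv (deg_exp lam x * deg_exp lam y) =
      fps_const (x + y) * (deg_exp lam x * deg_exp lam y)"
    unfolding deg_exp_ode by (simp add: algebra_simps flip: fps_const_add)
qed simp

text \<open>With \<open>u = 1 + lam * t\<close>, both sides times \<open>u\<close> equal
  \<open>x e^x\<close>, because \<open>u e' = e\<close> and \<open>e^x = e e^(x-1)\<close>; then
  \<open>u\<close> cancels.\<close>

lemma fps_deriv_deg_exp:
  "fps_deriv (deg_exp lam x) = fps_const x * fps_deriv (deg_exp lam 1) * deg_exp lam (x - 1)"
proof -
  let ?u = "1 + fps_const lam * fps_X :: real fps"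
  have "fps_nth ?u 0 = 1" by simp
  then have "?u \<noteq> 0" by fastforce
  moreover have "?u * fps_deriv (deg_exp lam x) =
      ?u * (fps_const x * fps_deriv (deg_exp lam 1) * deg_exp lam (x - 1))"
    using deg_exp_ode[of lam x] deg_exp_ode[of lam 1] deg_exp_add[of lam 1 "x - 1"]
    by (simp add: mult_ac)
  ultimately show ?thesis by (metis mult_left_cancel)
qed

lemma fps_deriv_deg_Bell_gf:
  "fps_deriv (deg_Bell_gf lam s x) = fps_const (of_int s) * fps_deriv (deg_exp lam 1) *
     deg_Bell_gf lam (s - 1) x + fps_const x * fps_deriv (deg_exp lam 1) * deg_Bell_gf lam s x"
proof -
  have "fps_deriv (fps_exp x oo (deg_exp lam 1 - 1)) =
      fps_const x * (fps_exp x oo (deg_exp lam 1 - 1)) * fps_deriv (deg_exp lam 1)"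
    by (simp add: fps_compose_deriv fps_compose_mult_distrib)
  then show ?thesis
    unfolding deg_Bell_gf_def
    by (simp add: fps_deriv_deg_exp[of lam "of_int s"] algebra_simps)
qed

text \<open>Each coefficient of the composition is a finite sum, so it can be differentiated
  termwise in \<open>x\<close>.\<close>

lemma has_real_derivative_fps_exp_compose_nth:
  fixes a :: "real fps"
  assumes "fps_nth a 0 = 0"
  shows "((\<lambda>x. fps_nth (fps_exp x oo a) n) has_real_derivative
    fps_nth (a * (fps_exp x oo a)) n) (at x)"
proof -
  have term_deriv: "((\<lambda>x. fps_nth (fps_exp x) i) has_real_derivative
      fps_nth (fps_X * fps_exp x) i) (at x)" for i
  proof (cases i)
    case (Suc j)
    have "((\<lambda>x. x ^ Suc j / fact (Suc j)) has_real_derivative real (Suc j) * x ^ j / fact (Suc j)) (at x)"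
      using DERIV_cdivide[OF DERIV_pow[of "Suc j" x UNIV], of "fact (Suc j)"] by simp
    also have "real (Suc j) * x ^ j / fact (Suc j) = x ^ j / fact j"
      by (simp add: fact_Suc del: of_nat_Suc)
    finally show ?thesis
      by (simp add: Suc del: fact_Suc power_Suc)
  qed simp
  \<comment> \<open>Differentiating \<open>exp (x t)\<close> in \<open>x\<close> multiplies it by
    \<open>t\<close>; composing with \<open>a\<close> turns that factor into
    \<open>a\<close>.\<close>
  have "a * (fps_exp x oo a) = (fps_X * fps_exp x) oo a"
    using assms by (simp add: fps_compose_mult_distrib)
  then show ?thesis
    unfolding fps_compose_nth
    by (auto intro!: DERIV_sum DERIV_cmult_right term_deriv simp: fps_compose_nth
        simp del: fps_exp_nth fps_X_mult_nth)
qed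

text \<open>The factor \<open>e^s\<close> is free of \<open>x\<close>, so only the composed
  exponential is differentiated, contributing \<open>e - 1\<close>.\<close>

lemma deriv_deg_Bell:
  "deriv (deg_Bell lam s n) x = fact n * fps_nth ((deg_exp lam 1 - 1) * deg_Bell_gf lam s x) n"
proof (rule DERIV_imp_deriv)
  let ?a = "deg_exp lam 1 - 1"
  have eq: "deg_Bell lam s n = (\<lambda>x. fact n *
      (\<Sum>i=0..n. fps_nth (deg_exp lam (of_int s)) i * fps_nth (fps_exp x oo ?a) (n - i)))"
    by (simp add: fun_eq_iff deg_Bell_def deg_Bell_gf_def fps_mult_nth)
  have "(deg_Bell lam s n has_real_derivative fact n * (\<Sum>i=0..n.
      fps_nth (deg_exp lam (of_int s)) i * fps_nth (?a * (fps_exp x oo ?a)) (n - i))) (at x)"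
    unfolding eq by (intro DERIV_cmult DERIV_sum has_real_derivative_fps_exp_compose_nth) simp
  also have "(\<Sum>i=0..n.
      fps_nth (deg_exp lam (of_int s)) i * fps_nth (?a * (fps_exp x oo ?a)) (n - i)) =
      fps_nth (?a * deg_Bell_gf lam s x) n"
    unfolding deg_Bell_gf_def mult.left_commute[of ?a] by (rule fps_mult_nth[symmetric])
  finally show "(deg_Bell lam s n has_real_derivative
      fact n * fps_nth (?a * deg_Bell_gf lam s x) n) (at x)" .
qed

text \<open>Binomial convolution: the coefficient of \<open>t^j / j!\<close> in \<open>e'\<close> is
  \<open>gen_ffact lam 1 (Suc j)\<close>, here with \<open>j = m - k\<close>.\<close>

lemma deg_exp_deriv_mult_deg_Bell_gf_nth:
  "fact m * fps_nth (fps_deriv (deg_exp lam 1) * deg_Bell_gf lam s x) m =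
    (\<Sum>k = 0..m. real (m choose k) * gen_ffact lam 1 (Suc m - k) * deg_Bell lam s k x)"
proof -
  have "fact m * (fps_nth (deg_Bell_gf lam s x) k * fps_nth (fps_deriv (deg_exp lam 1)) (m - k)) =
      real (m choose k) * gen_ffact lam 1 (Suc m - k) * deg_Bell lam s k x" if "k \<le> m" for k
  proof -
    have "fps_nth (fps_deriv (deg_exp lam 1)) (m - k) = gen_ffact lam 1 (Suc m - k) / fact (m - k)"
      using that by (simp add: deg_exp_def Suc_diff_le divide_simps)
    then show ?thesis
      using that by (simp add: deg_Bell_def binomial_fact)
  qed
  then show ?thesis
    by (subst mult.commute[of "fps_deriv _"])
      (simp only: fps_mult_nth sum_distrib_left, rule sum.cong, auto)
qed

lemma deg_exp_deriv_mult_deg_Bell_gf_recurrence: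
  assumes "n \<ge> 1"
  shows "fact n * fps_nth (fps_deriv (deg_exp lam 1) * deg_Bell_gf lam s x) n =
    deriv (deg_Bell lam s n) x + deg_Bell lam s n x - real n * lam *
    (\<Sum>k = 0..n - 1. real ((n - 1) choose k) * gen_ffact lam 1 (n - k) * deg_Bell lam s k x)"
proof -
  let ?G = "deg_Bell_gf lam s x" and ?d = "fps_deriv (deg_exp lam 1)"
  obtain m where m: "n = Suc m"
    using assms by (cases n) auto
  have "(1 + fps_const lam * fps_X) * ?d = deg_exp lam 1"
    using deg_exp_ode[of lam 1] by simp
  \<comment> \<open>Writing the \<open>e\<close> in \<open>e - 1\<close> as
    \<open>(1 + lam * t) e'\<close> leaves a ring identity.\<close>
  then have "?d * ?G = (deg_exp lam 1 - 1) * ?G + ?G - fps_const lam * (fps_X * (?d * ?G))"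
    by (elim subst) (simp add: algebra_simps)
  then have eq: "fps_nth (?d * ?G) n = fps_nth ((deg_exp lam 1 - 1) * ?G) n + fps_nth ?G n -
      lam * fps_nth (?d * ?G) m"
    unfolding m by (metis fps_X_mult_nth fps_add_nth fps_mult_left_const_nth fps_sub_nth
        diff_Suc_1 nat.distinct(1))
  \<comment> \<open>The factor \<open>t\<close> lowers the index to \<open>m = n - 1\<close>, and
    \<open>n! = n * m!\<close> yields the factor \<open>n\<close> before the sum.\<close>
  have "fact n * fps_nth (?d * ?G) n = fact n * fps_nth ((deg_exp lam 1 - 1) * ?G) n +
      fact n * fps_nth ?G n - real n * lam * (fact m * fps_nth (?d * ?G) m)"
    unfolding eq by (simp only: m fact_Suc) (simp add: algebra_simps)
  then show ?thesis
    unfolding deg_exp_deriv_mult_deg_Bell_gf_nth deriv_deg_Bell by (simp add: m deg_Bell_def)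
qed

theorem theorem1:
  fixes lam :: real and r n :: nat and x :: real
  assumes "lam \<noteq> 0" and "n \<ge> 1" and "x \<noteq> 0"
  shows "1 / x * deg_Bell lam (int r) (n + 1) x =
      deriv (deg_Bell lam (int r) n) x
    + real r / x * deriv (deg_Bell lam (int r - 1) n) x
    + deg_Bell lam (int r) n x
    + real r / x * deg_Bell lam (int r - 1) n x
    - real n * lam * (\<Sum>k = 0..n - 1. real ((n - 1) choose k) *
        gen_ffact lam 1 (n - k) * deg_Bell lam (int r) k x)
    - real r / x * real n * lam * (\<Sum>k = 0..n - 1. real ((n - 1) choose k) *
        gen_ffact lam 1 (n - k) * deg_Bell lam (int r - 1) k x)"
proof -
  let ?d = "fps_deriv (deg_exp lam 1)"
  \<comment> \<open>Raising the index of an exponential generating function by one is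
    differentiation in \<open>t\<close>.\<close>
  have "deg_Bell lam (int r) (n + 1) x = fact n * fps_nth (fps_deriv (deg_Bell_gf lam (int r) x)) n"
    by (simp add: deg_Bell_def)
  also have "\<dots> = real r * (fact n * fps_nth (?d * deg_Bell_gf lam (int r - 1) x) n) +
      x * (fact n * fps_nth (?d * deg_Bell_gf lam (int r) x) n)"
    unfolding fps_deriv_deg_Bell_gf by (simp add: mult.assoc distrib_left mult.left_commute)
  finally have "1 / x * deg_Bell lam (int r) (n + 1) x =
      real r / x * (fact n * fps_nth (?d * deg_Bell_gf lam (int r - 1) x) n) +
      fact n * fps_nth (?d * deg_Bell_gf lam (int r) x) n"
    using assms(3) by (simp add: field_simps)
  \<comment> \<open>The same recurrence, for \<open>s = r\<close> and \<open>s = r - 1\<close>,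
    expands both \<open>e'\<close> products into three terms each.\<close>
  then show ?thesis
    unfolding deg_exp_deriv_mult_deg_Bell_gf_recurrence[OF assms(2)] by (simp add: algebra_simps)
qed

end
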